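(* Let $D\subset\mathbb R^2$ be a bounded domain such that for every continuous $g:\partial D\to\mathbb R$ there is $u_g\in C^2(D)\cap C(\overline D)$ with $\Delta u_g=0$ on $D$ and $u_g=g$ on $\partial D$, and for $x\in D$ let $I_x(g):=u_g(x)$ on $C(\partial D)$. Let $\mathcal L_x$ and $\int_x$ be the class of integrable functions and Daniell integral on $\partial D$ obtained from the $I$-integral $I_x$. If $f\in\mathcal L_x$ for some $x\in D$, then $f\in\mathcal L_y$ for every $y\in D$, and the function $v_f:D\to\mathbb R$, $v_f(y):=\int_y f$, is harmonic on $D$.
   Context: $\Delta u=\partial_1^2u+\partial_2^2u$; a function is harmonic on an open set if it is $C^2$ there with $\Delta u=0$. A domain is a connected open set. $\overline{\mathbb R}=\mathbb R\cup\{\pm\infty\}$. For each $x\in D$, $I_x$ is an $I$-integral on $C(\partial D)$ (linear, positive, and $I_x(g_n)\to0$ whenever $g_n\searrow0$ pointwise). The Daniell extension: $T_1$ is the set of functions $\partial D\to\overline{\mathbb R}$ that are pointwise limits of pointwise nondecreasing sequences $(g_n)\subset C(\partial D)$; $I_{1,x}(\varphi):=\lim_n I_x(g_n)\in\mathbb R\cup\{\infty\}$ for such a sequence (independent of choice); $\overline I_x(f):=\inf\{I_{1,x}(\varphi):\varphi\in T_1,\ \varphi\ge f\}$ (with $\inf\emptyset=+\infty$), $\underline I_x(f):=-\overline I_x(-f)$; $\mathcal L_x:=\{f:\partial D\to\overline{\mathbb R}\,:\ \overline I_x(f)=\underline I_x(f)\in\mathbb R\}$ and $\int_x f$ is the common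 value. *)

theory Defs
  imports "HOL-Analysis.Analysis"
begin

type_synonym pt = "real \<times> real"

definition d1 :: "(pt \<Rightarrow> real) \<Rightarrow> pt \<Rightarrow> real" where
  "d1 u z = deriv (\<lambda>t. u (t, snd z)) (fst z)"

definition d2 :: "(pt \<Rightarrow> real) \<Rightarrow> pt \<Rightarrow> real" where
  "d2 u z = deriv (\<lambda>t. u (fst z, t)) (snd z)"

definition partials_exist_on :: "pt set \<Rightarrow> (pt \<Rightarrow> real) \<Rightarrow> bool" where
  "partials_exist_on S u \<longleftrightarrow>
     (\<forall>z\<in>S. (\<lambda>t. u (t, snd z)) field_differentiable (at (fst z)) \<and>
            (\<lambda>t. u (fst z, t)) field_differentiable (at (snd z)))"

definition C2_on :: "pt set \<Rightarrow> (pt \<Rightarrow> real) \<Rightarrow> bool" where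
  "C2_on S u \<longleftrightarrow>
     partials_exist_on S u \<and> partials_exist_on S (d1 u) \<and> partials_exist_on S (d2 u) \<and>
     continuous_on S u \<and> continuous_on S (d1 u) \<and> continuous_on S (d2 u) \<and>
     continuous_on S (d1 (d1 u)) \<and> continuous_on S (d2 (d1 u)) \<and>
     continuous_on S (d1 (d2 u)) \<and> continuous_on S (d2 (d2 u))"

definition laplacian :: "(pt \<Rightarrow> real) \<Rightarrow> pt \<Rightarrow> real" where
  "laplacian u z = d1 (d1 u) z + d2 (d2 u) z"

definition harmonic_on :: "pt set \<Rightarrow> (pt \<Rightarrow> real) \<Rightarrow> bool" where
  "harmonic_on S u \<longleftrightarrow> open S \<and> C2_on S u \<and> (\<forall>z\<in>S. laplacian u z = 0)"

definition dirichlet_sol :: "pt set \<Rightarrow> (pt \<Rightarrow> real) \<Rightarrow> pt \<Rightarrow> real" where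
  "dirichlet_sol D g = (SOME u. harmonic_on D u \<and> continuous_on (closure D) u \<and>
                                (\<forall>z\<in>frontier D. u z = g z))"

definition Ix :: "pt set \<Rightarrow> pt \<Rightarrow> (pt \<Rightarrow> real) \<Rightarrow> real" where
  "Ix D x g = dirichlet_sol D g x"

text \<open>Daniell extension of a functional I on C(B), B the underlying (compact) set.
  Functions B -> extended reals are represented as pt => ereal; only values on B matter.\<close>

definition approx_seq :: "pt set \<Rightarrow> (nat \<Rightarrow> pt \<Rightarrow> real) \<Rightarrow> (pt \<Rightarrow> ereal) \<Rightarrow> bool" where
  "approx_seq B g \<phi> \<longleftrightarrow>
     (\<forall>n. continuous_on B (g n)) \<and>
     (\<forall>x\<in>B. \<forall>n. g n x \<le> g (Suc n) x) \<and>
     (\<forall>x\<in>B. (\<lambda>n. ereal (g n x)) \<longlonglongrightarrow> \<phi> x)"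

definition T1 :: "pt set \<Rightarrow> (pt \<Rightarrow> ereal) set" where
  "T1 B = {\<phi>. \<exists>g. approx_seq B g \<phi>}"

definition I1 :: "pt set \<Rightarrow> ((pt \<Rightarrow> real) \<Rightarrow> real) \<Rightarrow> (pt \<Rightarrow> ereal) \<Rightarrow> ereal" where
  "I1 B I \<phi> = (SOME L. \<exists>g. approx_seq B g \<phi> \<and> (\<lambda>n. ereal (I (g n))) \<longlonglongrightarrow> L)"

definition upper_int :: "pt set \<Rightarrow> ((pt \<Rightarrow> real) \<Rightarrow> real) \<Rightarrow> (pt \<Rightarrow> ereal) \<Rightarrow> ereal" where
  "upper_int B I f = Inf {I1 B I \<phi> | \<phi>. \<phi> \<in> T1 B \<and> (\<forall>x\<in>B. f x \<le> \<phi> x)}"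

definition lower_int :: "pt set \<Rightarrow> ((pt \<Rightarrow> real) \<Rightarrow> real) \<Rightarrow> (pt \<Rightarrow> ereal) \<Rightarrow> ereal" where
  "lower_int B I f = - upper_int B I (\<lambda>x. - f x)"

definition daniell_L :: "pt set \<Rightarrow> ((pt \<Rightarrow> real) \<Rightarrow> real) \<Rightarrow> (pt \<Rightarrow> ereal) set" where
  "daniell_L B I = {f. upper_int B I f = lower_int B I f \<and> \<bar>upper_int B I f\<bar> \<noteq> \<infinity>}"

definition daniell_int :: "pt set \<Rightarrow> ((pt \<Rightarrow> real) \<Rightarrow> real) \<Rightarrow> (pt \<Rightarrow> ereal) \<Rightarrow> real" where
  "daniell_int B I f = real_of_ereal (upper_int B I f)"

end

theory Submission
  imports Defs "HOL-Complex_Analysis.Complex_Analysis"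
begin

text \<open>
  On a disc a harmonic function is the real part of a holomorphic function \<open>F\<close>. If it is nonnegative,
  the Schwarz lemma applied to the Cayley transform of \<open>F\<close> bounds \<open>F\<close> on the half disc by three times
  its value at the centre. This gives Harnack's inequality, chained along the connected set \<open>D\<close>,
  and shows that locally uniform limits of harmonic functions are harmonic.

  For \<open>\<phi>\<close> in \<open>T\<^sub>1\<close> the function \<open>y \<mapsto> I\<^bsub>1,y\<^esub>(\<phi>)\<close> is an increasing limit of harmonic functions, so by
  Harnack it is finite and harmonic on \<open>D\<close> as soon as it is finite at \<open>x\<close>. If \<open>f\<close> is integrable at \<open>x\<close>,
  the upper and lower integrals of \<open>f\<close> are therefore squeezed between harmonic functions whose
  difference is nonnegative and arbitrarily small at \<open>x\<close>, hence, again by Harnack, arbitrarily small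
  locally uniformly on \<open>D\<close>.
\<close>

section \<open>Harmonic functions as real parts of holomorphic functions\<close>

lemma partials_exist_onD:
  assumes "partials_exist_on S u" "(a, b) \<in> S"
  shows "((\<lambda>t. u (t, b)) has_real_derivative d1 u (a, b)) (at a)"
    and "((\<lambda>t. u (a, t)) has_real_derivative d2 u (a, b)) (at b)"
  using assms unfolding partials_exist_on_def d1_def d2_def
  by (fastforce simp: DERIV_deriv_iff_field_differentiable)+

text \<open>A displacement is split into a horizontal step along the line through \<open>b\<close>
  and a vertical step; continuity of \<open>d2 u\<close> controls the vertical step uniformly in the
  first coordinate.\<close>

lemma has_derivative_of_partials:
  assumes "open S" "partials_exist_on S u" "continuous_on S (d2 u)" "(a, b) \<in> S"
  shows "(u has_derivative (\<lambda>(h, k). d1 u (a, b) * h + d2 u (a, b) * k)) (at (a, b))"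
proof -
  obtain A B where AB: "open A" "open B" "a \<in> A" "b \<in> B" "A \<times> B \<subseteq> S"
    using open_prod_elim[OF assms(1,4)] by (metis mem_Sigma_iff)
  \<comment> \<open>The second factor is shrunk to a ball because the vertical step needs a convex
    set.\<close>
  obtain r where r: "r > 0" "ball b r \<subseteq> B"
    using AB openE by blast
  let ?Y = "ball b r"
  have sub: "A \<times> ?Y \<subseteq> S" using AB r by blast
  have "((\<lambda>(x, y). u (x, y)) has_derivative
      (\<lambda>(tx, ty). d1 u (a, b) * tx + blinfun_mult_right (d2 u (a, b)) ty)) (at (a, b) within A \<times> ?Y)"
  proof (rule has_derivative_partialsI[where fy = "\<lambda>x y. blinfun_mult_right (d2 u (x, y))"])
    show "((\<lambda>x. u (x, b)) has_derivative (*) (d1 u (a, b))) (at a within A)"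
      using partials_exist_onD(1)[OF assms(2,4)]
      by (simp add: has_field_derivative_def has_derivative_at_withinI)
    show "((\<lambda>y. u (x, y)) has_derivative blinfun_apply (blinfun_mult_right (d2 u (x, y)))) (at y within ?Y)"
      if "x \<in> A" "y \<in> ?Y" for x y
    proof -
      have "(x, y) \<in> S" using that sub by blast
      from partials_exist_onD(2)[OF assms(2) this] show ?thesis
        by (simp add: has_field_derivative_def has_derivative_at_withinI)
    qed
    have "isCont (d2 u) (a, b)"
      using assms by (simp add: continuous_on_eq_continuous_at)
    then have "isCont (\<lambda>z. blinfun_mult_right (d2 u z)) (a, b)"
      by (intro bounded_linear.isCont[OF bounded_linear_blinfun_mult_right])
    then show "continuous (at (a, b) within A \<times> ?Y) (\<lambda>(x, y). blinfun_mult_right (d2 u (x, y)))"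
      by (simp add: case_prod_unfold continuous_at_imp_continuous_within)
  qed (use r in auto)
  moreover have "at (a, b) within A \<times> ?Y = at (a, b)"
    using AB r by (intro at_within_open open_Times) auto
  ultimately show ?thesis
    by (simp add: case_prod_unfold)
qed

text \<open>The second difference of \<open>u\<close> over a small square of side \<open>h\<close>
  equals \<open>h * h\<close> times either mixed partial at some point of the square, by the mean
  value theorem in the two possible orders. Continuity at \<open>z\<close> then leaves no room for a
  gap.\<close>

lemma mixed_partials_eq:
  assumes "open S" "partials_exist_on S u" "partials_exist_on S (d1 u)" "partials_exist_on S (d2 u)"
    and "continuous_on S (d2 (d1 u))" "continuous_on S (d1 (d2 u))" "z \<in> S"
  shows "d2 (d1 u) z = d1 (d2 u) z"
proof (rule ccontr)
  assume ne: "d2 (d1 u) z \<noteq> d1 (d2 u) z"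
  \<comment> \<open>Half the gap: two errors below \<open>e\<close> cannot bridge it.\<close>
  define e where "e = \<bar>d2 (d1 u) z - d1 (d2 u) z\<bar> / 2"
  have e: "e > 0" using ne by (simp add: e_def)
  obtain a b where z: "z = (a, b)" by fastforce
  have "isCont (d2 (d1 u)) z" "isCont (d1 (d2 u)) z"
    using assms by (auto simp: continuous_on_eq_continuous_at)
  then have "\<exists>r1>0. \<forall>w. dist w z < r1 \<longrightarrow> dist (d2 (d1 u) w) (d2 (d1 u) z) < e"
    "\<exists>r2>0. \<forall>w. dist w z < r2 \<longrightarrow> dist (d1 (d2 u) w) (d1 (d2 u) z) < e"
    using e unfolding continuous_at_eps_delta by simp_all
  then obtain r1 r2 where r12: "r1 > 0" "\<And>w. dist w z < r1 \<Longrightarrow> dist (d2 (d1 u) w) (d2 (d1 u) z) < e"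
    "r2 > 0" "\<And>w. dist w z < r2 \<Longrightarrow> dist (d1 (d2 u) w) (d1 (d2 u) z) < e"
    by auto
  obtain r3 where r3: "r3 > 0" "ball z r3 \<subseteq> S"
    using openE[OF assms(1,7)] by auto
  \<comment> \<open>Points of the square lie within \<open>2 * h\<close> of the corner
    \<open>z\<close>, strictly less than each of the three radii.\<close>
  define h where "h = min r1 (min r2 r3) / 3"
  have h: "h > 0" using r12 r3 by (simp add: h_def)
  have near: "dist (s, t) z < r1" "dist (s, t) z < r2" "(s, t) \<in> S"
    if "a \<le> s" "s \<le> a + h" "b \<le> t" "t \<le> b + h" for s t
  proof -
    have "dist (s, t) (a, b) \<le> \<bar>s - a\<bar> + \<bar>t - b\<bar>"
      using sqrt_sum_squares_le_sum_abs by (simp add: dist_Pair_Pair dist_real_def)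
    also have "\<dots> < 3 * h" using that h by linarith
    finally have "dist (s, t) z < min r1 (min r2 r3)" by (simp add: z h_def)
    then show "dist (s, t) z < r1" "dist (s, t) z < r2" "(s, t) \<in> S"
      using r3 by (auto simp: dist_commute)
  qed
  have "\<exists>s. a < s \<and> s < a + h \<and> (u (a + h, b + h) - u (a + h, b)) - (u (a, b + h) - u (a, b))
      = (a + h - a) * (d1 u (s, b + h) - d1 u (s, b))"
    using h by (intro MVT2 DERIV_diff partials_exist_onD(1)[OF assms(2)] near(3)) auto
  then obtain s where s: "a < s" "s < a + h" and s_eq:
    "(u (a + h, b + h) - u (a + h, b)) - (u (a, b + h) - u (a, b)) = h * (d1 u (s, b + h) - d1 u (s, b))"
    by auto
  have "\<exists>t. b < t \<and> t < b + h \<and> d1 u (s, b + h) - d1 u (s, b) = (b + h - b) * d2 (d1 u) (s, t)"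
    using h s by (intro MVT2 partials_exist_onD(2)[OF assms(3)] near(3)) auto
  then obtain t where t: "b < t" "t < b + h" "d1 u (s, b + h) - d1 u (s, b) = h * d2 (d1 u) (s, t)"
    by auto
  \<comment> \<open>The same second difference, regrouped so that the vertical variable is treated
    first.\<close>
  have "\<exists>t. b < t \<and> t < b + h \<and> (u (a + h, b + h) - u (a, b + h)) - (u (a + h, b) - u (a, b))
      = (b + h - b) * (d2 u (a + h, t) - d2 u (a, t))"
    using h by (intro MVT2 DERIV_diff partials_exist_onD(2)[OF assms(2)] near(3)) auto
  then obtain t' where t': "b < t'" "t' < b + h" and t'_eq:
    "(u (a + h, b + h) - u (a, b + h)) - (u (a + h, b) - u (a, b)) = h * (d2 u (a + h, t') - d2 u (a, t'))"
    by auto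
  have "\<exists>s. a < s \<and> s < a + h \<and> d2 u (a + h, t') - d2 u (a, t') = (a + h - a) * d1 (d2 u) (s, t')"
    using h t' by (intro MVT2 partials_exist_onD(1)[OF assms(4)] near(3)) auto
  then obtain s' where s': "a < s'" "s' < a + h" "d2 u (a + h, t') - d2 u (a, t') = h * d1 (d2 u) (s', t')"
    by auto
  have "h * (h * d2 (d1 u) (s, t)) = h * (h * d1 (d2 u) (s', t'))"
    using s_eq[unfolded t(3)] t'_eq[unfolded s'(3)] by linarith
  then have "d2 (d1 u) (s, t) = d1 (d2 u) (s', t')"
    using h by simp
  moreover have "dist (d2 (d1 u) (s, t)) (d2 (d1 u) z) < e"
    using s t by (intro r12 near) auto
  moreover have "dist (d1 (d2 u) (s', t')) (d1 (d2 u) z) < e"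
    using s' t' by (intro r12 near) auto
  ultimately show False
    by (auto simp: e_def dist_real_def abs_if split: if_splits)
qed

section \<open>Transfer between the real plane and the complex plane\<close>

definition cpt :: "pt \<Rightarrow> complex" where
  "cpt z = Complex (fst z) (snd z)"

lemma Re_cpt [simp]: "Re (cpt z) = fst z" and Im_cpt [simp]: "Im (cpt z) = snd z"
  by (simp_all add: cpt_def)

lemma dist_cpt: "dist (cpt z) (cpt w) = dist z w"
  by (cases z; cases w) (simp add: dist_norm cmod_def dist_Pair_Pair norm_Pair dist_real_def)

lemma cpt_image_ball: "cpt ` ball z r = ball (cpt z) r"
proof
  show "ball (cpt z) r \<subseteq> cpt ` ball z r"
  proof
    fix w assume w: "w \<in> ball (cpt z) r"
    have "w = cpt (Re w, Im w)" by (simp add: cpt_def)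
    then show "w \<in> cpt ` ball z r"
      using w by (metis dist_cpt image_eqI mem_ball)
  qed
qed (auto simp: dist_cpt)

lemma bounded_linear_cpt: "bounded_linear cpt"
proof (rule bounded_linear_intro[where K = 1])
  show "norm (cpt z) \<le> norm z * 1" for z
    using dist_cpt[of z 0] by (simp add: dist_norm cpt_def flip: zero_complex.code)
qed (auto simp: complex_eq_iff)

definition real_part_on :: "pt set \<Rightarrow> (pt \<Rightarrow> real) \<Rightarrow> (complex \<Rightarrow> complex) \<Rightarrow> bool" where
  "real_part_on S u F \<longleftrightarrow> F holomorphic_on cpt ` S \<and> (\<forall>w\<in>S. u w = Re (F (cpt w)))"

text \<open>Differentiating \<open>F\<close> along the directions 1 and \<open>\<i>\<close> gives
  \<open>deriv F\<close> and \<open>\<i> * deriv F\<close>. The partials are thus again real parts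
  of holomorphic functions, so the lemma can be iterated to reach second derivatives.\<close>

lemma real_part_on_ball:
  assumes "real_part_on (ball c r) u F"
  shows "partials_exist_on (ball c r) u" "continuous_on (ball c r) u"
    and "real_part_on (ball c r) (d1 u) (deriv F)"
    and "real_part_on (ball c r) (d2 u) (\<lambda>z. \<i> * deriv F z)"
proof -
  let ?B = "ball c r"
  have hol: "F holomorphic_on ball (cpt c) r" and u: "\<And>w. w \<in> ?B \<Longrightarrow> u w = Re (F (cpt w))"
    using assms by (auto simp: real_part_on_def cpt_image_ball)
  have hol': "deriv F holomorphic_on ball (cpt c) r"
    using hol by (simp add: holomorphic_deriv)
  have D: "(u has_derivative (\<lambda>h. Re (deriv F (cpt w) * cpt h))) (at w)" if "w \<in> ?B" for w
  proof -
    have "cpt w \<in> ball (cpt c) r" using that by (simp add: dist_cpt)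
    then have "(F has_field_derivative deriv F (cpt w)) (at (cpt w))"
      using hol holomorphic_derivI open_ball by blast
    then have "(F has_derivative (*) (deriv F (cpt w))) (at (cpt w))"
      by (simp add: has_field_derivative_def)
    then have "((\<lambda>w. Re (F (cpt w))) has_derivative (\<lambda>h. Re (deriv F (cpt w) * cpt h))) (at w)"
      by (intro has_derivative_Re has_derivative_compose[OF bounded_linear_imp_has_derivative[OF bounded_linear_cpt]])
    then show ?thesis
      by (rule has_derivative_transform_within_open[OF _ open_ball that]) (simp add: u)
  qed
  have D1: "((\<lambda>t. u (t, b)) has_real_derivative Re (deriv F (cpt (a, b)))) (at a)"
    and D2: "((\<lambda>t. u (a, t)) has_real_derivative Re (\<i> * deriv F (cpt (a, b)))) (at b)"
    if "(a, b) \<in> ?B" for a b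
  proof -
    have "((\<lambda>t. (t, b)) has_derivative (\<lambda>h. (h, 0))) (at a)" "((\<lambda>t. (a, t)) has_derivative (\<lambda>h. (0, h))) (at b)"
      by (auto intro!: derivative_eq_intros)
    from this[THEN has_derivative_compose, OF D[OF that]]
    show "((\<lambda>t. u (t, b)) has_real_derivative Re (deriv F (cpt (a, b)))) (at a)"
      "((\<lambda>t. u (a, t)) has_real_derivative Re (\<i> * deriv F (cpt (a, b)))) (at b)"
      by (auto simp: has_field_derivative_def cpt_def fun_eq_iff elim!: has_derivative_eq_rhs)
  qed
  show "partials_exist_on ?B u"
    unfolding partials_exist_on_def field_differentiable_def
    by (metis D1 D2 prod.collapse)
  show "continuous_on ?B u"
    using D by (auto intro!: continuous_at_imp_continuous_on has_derivative_continuous)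
  show "real_part_on ?B (d1 u) (deriv F)" "real_part_on ?B (d2 u) (\<lambda>z. \<i> * deriv F z)"
    unfolding real_part_on_def cpt_image_ball
    using D1 D2 hol' by (auto simp del: Re_i_times simp: d1_def d2_def intro!: DERIV_imp_deriv holomorphic_intros)
qed

text \<open>Every clause of \<open>harmonic_on\<close> is either a pointwise condition or continuity
  on an open set, and both can be checked on a disc around each point.\<close>

lemma harmonic_on_local:
  assumes "open S" "\<And>z. z \<in> S \<Longrightarrow> \<exists>r>0. ball z r \<subseteq> S \<and> harmonic_on (ball z r) u"
  shows "harmonic_on S u"
proof -
  have cont: "continuous_on S k"
    if "\<And>z r. harmonic_on (ball z r) u \<Longrightarrow> continuous_on (ball z r) k" for k :: "pt \<Rightarrow> real"
  proof (rule continuous_at_imp_continuous_on, intro ballI)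
    fix z assume "z \<in> S"
    then obtain r where "r > 0" "harmonic_on (ball z r) u" using assms by blast
    then show "isCont k z" using that[of z r] by (simp add: continuous_on_eq_continuous_at)
  qed
  have P: "P z" if "\<And>z r. r > 0 \<Longrightarrow> harmonic_on (ball z r) u \<Longrightarrow> P z" "z \<in> S" for P z
    using assms that by blast
  have part: "partials_exist_on S k"
    if "\<And>z r. harmonic_on (ball z r) u \<Longrightarrow> partials_exist_on (ball z r) k" for k :: "pt \<Rightarrow> real"
    unfolding partials_exist_on_def
  proof
    fix z assume "z \<in> S"
    then show "(\<lambda>t. k (t, snd z)) field_differentiable at (fst z) \<and> (\<lambda>t. k (fst z, t)) field_differentiable at (snd z)"
      by (rule P[rotated]) (use that in \<open>auto simp: partials_exist_on_def\<close>)
  qed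
  have "\<forall>z\<in>S. laplacian u z = 0"
    by (intro ballI, rule P) (auto simp: harmonic_on_def)
  then show ?thesis
    unfolding harmonic_on_def C2_on_def using assms(1)
    by (intro conjI cont part) (auto simp: harmonic_on_def C2_on_def)
qed

lemma harmonic_on_subset:
  assumes "harmonic_on S u" "T \<subseteq> S" "open T"
  shows "harmonic_on T u"
  using assms unfolding harmonic_on_def C2_on_def partials_exist_on_def
  by (auto intro: continuous_on_subset)

lemma harmonic_on_real_part:
  assumes "real_part_on (ball c r) u F"
  shows "harmonic_on (ball c r) u"
proof -
  note 1 = real_part_on_ball[OF assms]
  \<comment> \<open>Second differentiation, of \<open>d1 u\<close> through \<open>deriv F\<close>
    and of \<open>d2 u\<close> through \<open>\<i> * deriv F\<close>; the two pure second partials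
    come out as the real parts of F'' and -F''.\<close>
  note 2 = real_part_on_ball[OF 1(3)] real_part_on_ball[OF 1(4)]
  have "laplacian u w = 0" if w: "w \<in> ball c r" for w
  proof -
    have "F holomorphic_on ball (cpt c) r"
      using assms by (simp add: real_part_on_def cpt_image_ball)
    then have "deriv F holomorphic_on ball (cpt c) r"
      by (simp add: holomorphic_deriv)
    then have "deriv (\<lambda>z. \<i> * deriv F z) (cpt w) = \<i> * deriv (deriv F) (cpt w)"
      using w by (intro deriv_cmult) (auto simp: dist_cpt intro: holomorphic_on_imp_differentiable_at)
    then show ?thesis
      using 2(3,8) w by (simp add: laplacian_def real_part_on_def)
  qed
  then show ?thesis
    unfolding harmonic_on_def C2_on_def using 1 2
      2(3,4,7,8)[THEN real_part_on_ball(2)] by auto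
qed

text \<open>The function \<open>f\<close>, which is \<open>d1 u - \<i> * d2 u\<close>, is
  holomorphic and has a primitive on the disc, whose real part has the same gradient as
  \<open>u\<close>. The primitive is free up to a constant; making it real at the centre prepares
  for the Schwarz lemma estimate.\<close>

lemma harmonic_on_ball_imp_real_part:
  assumes "harmonic_on (ball c r) u" "r > 0"
  obtains F where "real_part_on (ball c r) u F" "Im (F (cpt c)) = 0"
proof -
  let ?B = "ball c r" and ?pt = "\<lambda>z. (Re z, Im z)"
  have pe: "partials_exist_on ?B u" "partials_exist_on ?B (d1 u)" "partials_exist_on ?B (d2 u)"
    and co: "continuous_on ?B (d1 u)" "continuous_on ?B (d2 u)" "continuous_on ?B (d2 (d1 u))"
        "continuous_on ?B (d1 (d2 u))" "continuous_on ?B (d2 (d2 u))"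
    and lap: "\<And>w. w \<in> ?B \<Longrightarrow> d1 (d1 u) w + d2 (d2 u) w = 0"
    using assms by (auto simp: harmonic_on_def C2_on_def laplacian_def)
  define f where "f z = Complex (d1 u (?pt z)) (- d2 u (?pt z))" for z
  have cpt_pt: "cpt (?pt z) = z" for z by (simp add: cpt_def)
  have mem: "?pt z \<in> ?B" if "z \<in> ball (cpt c) r" for z
    using that dist_cpt[of c "?pt z"] by (simp only: cpt_pt mem_ball)
  have pt_der: "(?pt has_derivative ?pt) (at z)" for z
    by (intro derivative_intros)
  have "(f has_field_derivative Complex (d1 (d1 u) (?pt z)) (- d1 (d2 u) (?pt z))) (at z)"
    if "z \<in> ball (cpt c) r" for z
  proof -
    note m = mem[OF that]
    have eq: "d2 (d1 u) (?pt z) = d1 (d2 u) (?pt z)"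
      using pe co m by (intro mixed_partials_eq[of ?B]) auto
    have lap': "d2 (d2 u) (?pt z) = - d1 (d1 u) (?pt z)"
      using lap[OF m] by simp
    have 1: "((\<lambda>z. d1 u (?pt z)) has_derivative (\<lambda>h. d1 (d1 u) (?pt z) * Re h + d2 (d1 u) (?pt z) * Im h)) (at z)"
      using has_derivative_compose[OF pt_der has_derivative_of_partials[OF _ pe(2) co(3) m]] by simp
    have 2: "((\<lambda>z. d2 u (?pt z)) has_derivative (\<lambda>h. d1 (d2 u) (?pt z) * Re h + d2 (d2 u) (?pt z) * Im h)) (at z)"
      using has_derivative_compose[OF pt_der has_derivative_of_partials[OF _ pe(3) co(5) m]] by simp
    have "((\<lambda>z. complex_of_real (d1 u (?pt z)) - \<i> * complex_of_real (d2 u (?pt z))) has_derivative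
       (\<lambda>h. complex_of_real (d1 (d1 u) (?pt z) * Re h + d2 (d1 u) (?pt z) * Im h)
          - \<i> * complex_of_real (d1 (d2 u) (?pt z) * Re h + d2 (d2 u) (?pt z) * Im h))) (at z)"
      by (intro has_derivative_diff has_derivative_mult_right has_derivative_of_real 1 2)
    moreover have "f = (\<lambda>z. complex_of_real (d1 u (?pt z)) - \<i> * complex_of_real (d2 u (?pt z)))"
      by (auto simp: f_def complex_eq_iff)
    ultimately have "(f has_derivative
       (\<lambda>h. complex_of_real (d1 (d1 u) (?pt z) * Re h + d2 (d1 u) (?pt z) * Im h)
          - \<i> * complex_of_real (d1 (d2 u) (?pt z) * Re h + d2 (d2 u) (?pt z) * Im h))) (at z)"
      by simp
    \<comment> \<open>The Cauchy-Riemann equations for \<open>f\<close> are exactly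
      \<open>eq\<close> and \<open>lap'\<close>: they turn the real differential into multiplication
      by a complex number.\<close>
    then show ?thesis
      unfolding has_field_derivative_def
      by (rule has_derivative_eq_rhs) (simp add: fun_eq_iff complex_eq_iff eq lap')
  qed
  then have "f holomorphic_on ball (cpt c) r"
    using holomorphic_on_open by blast
  then obtain G where G: "\<And>z. z \<in> ball (cpt c) r \<Longrightarrow> (G has_field_derivative f z) (at z within ball (cpt c) r)"
    using holomorphic_convex_primitive'[OF convex_ball open_ball] by blast
  then have G': "(G has_derivative (*) (f z)) (at z)" if "z \<in> ball (cpt c) r" for z
    using that by (metis has_field_derivative_def at_within_open open_ball)
  have "\<exists>k. \<forall>w\<in>?B. u w - Re (G (cpt w)) = k"
  proof (rule has_derivative_zero_constant)
    fix w assume w: "w \<in> ?B"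
    obtain a b where ab: "w = (a, b)" by fastforce
    have "cpt w \<in> ball (cpt c) r" using w by (simp add: dist_cpt)
    then have "((\<lambda>w. Re (G (cpt w))) has_derivative (\<lambda>h. Re (f (cpt w) * cpt h))) (at w)"
      by (intro has_derivative_Re has_derivative_compose[OF bounded_linear_imp_has_derivative[OF bounded_linear_cpt]] G')
    moreover have "(u has_derivative (\<lambda>(h, k). d1 u w * h + d2 u w * k)) (at w)"
      using has_derivative_of_partials[OF open_ball pe(1) co(2)] w ab by blast
    ultimately have "((\<lambda>w. u w - Re (G (cpt w))) has_derivative
        (\<lambda>h. (case h of (h, k) \<Rightarrow> d1 u w * h + d2 u w * k) - Re (f (cpt w) * cpt h))) (at w)"
      by (intro has_derivative_diff)
    then have "((\<lambda>w. u w - Re (G (cpt w))) has_derivative (\<lambda>h. 0)) (at w)"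
      by (rule has_derivative_eq_rhs) (auto simp: fun_eq_iff f_def)
    then show "((\<lambda>w. u w - Re (G (cpt w))) has_derivative (\<lambda>h. 0)) (at w within ?B)"
      by (rule has_derivative_at_withinI)
  qed simp
  then obtain k where k: "\<And>w. w \<in> ?B \<Longrightarrow> u w - Re (G (cpt w)) = k" by blast
  \<comment> \<open>The real part of the constant makes the real part of \<open>F\<close> equal to
    \<open>u\<close>; its imaginary part makes \<open>F\<close> real at the centre.\<close>
  define F where "F z = G z + Complex k (- Im (G (cpt c)))" for z
  have "G holomorphic_on ball (cpt c) r"
    using G holomorphic_on_def field_differentiable_def by blast
  then have "F holomorphic_on ball (cpt c) r"
    unfolding F_def by (intro holomorphic_intros)
  then have "real_part_on ?B u F"
    using k by (force simp: real_part_on_def cpt_image_ball F_def)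
  then show thesis
    by (rule that) (simp add: F_def)
qed

section \<open>Linear combinations of harmonic functions\<close>

lemma harmonic_onI_real_part:
  assumes "open S" "\<And>z. z \<in> S \<Longrightarrow> \<exists>r>0. \<exists>F. ball z r \<subseteq> S \<and> real_part_on (ball z r) u F"
  shows "harmonic_on S u"
  using assms harmonic_on_real_part by (intro harmonic_on_local) blast+

lemma harmonic_on_lincomb:
  assumes "harmonic_on S u" "harmonic_on S v"
  shows "harmonic_on S (\<lambda>z. a * u z + b * v z)"
proof (rule harmonic_onI_real_part)
  show S: "open S" using assms by (simp add: harmonic_on_def)
  fix z assume "z \<in> S"
  then obtain r where r: "r > 0" "ball z r \<subseteq> S" using S openE by blast
  obtain F where F: "real_part_on (ball z r) u F"
    using harmonic_on_ball_imp_real_part[OF harmonic_on_subset[OF assms(1) r(2) open_ball] r(1)] by blast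
  obtain G where G: "real_part_on (ball z r) v G"
    using harmonic_on_ball_imp_real_part[OF harmonic_on_subset[OF assms(2) r(2) open_ball] r(1)] by blast
  have "real_part_on (ball z r) (\<lambda>z. a * u z + b * v z) (\<lambda>z. of_real a * F z + of_real b * G z)"
    using F G by (auto simp: real_part_on_def intro!: holomorphic_intros)
  then show "\<exists>r>0. \<exists>F. ball z r \<subseteq> S \<and> real_part_on (ball z r) (\<lambda>z. a * u z + b * v z) F"
    using r by blast
qed

lemma harmonic_on_const:
  assumes "open S"
  shows "harmonic_on S (\<lambda>z. k)"
proof (rule harmonic_onI_real_part[OF assms])
  fix z assume "z \<in> S"
  then obtain r where "r > 0" "ball z r \<subseteq> S" using assms openE by blast
  moreover have "real_part_on (ball z r) (\<lambda>z. k) (\<lambda>z. of_real k)"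
    by (simp add: real_part_on_def)
  ultimately show "\<exists>r>0. \<exists>F. ball z r \<subseteq> S \<and> real_part_on (ball z r) (\<lambda>z. k) F"
    by blast
qed

lemma
  assumes "harmonic_on S u" "harmonic_on S v"
  shows harmonic_on_add: "harmonic_on S (\<lambda>z. u z + v z)"
    and harmonic_on_diff: "harmonic_on S (\<lambda>z. u z - v z)"
  using harmonic_on_lincomb[OF assms, of 1 1] harmonic_on_lincomb[OF assms, of 1 "-1"] by simp_all

section \<open>Harnack inequality and uniform limits\<close>

text \<open>The shift by \<open>e\<close> makes the real part strictly positive, so that the Cayley transform \<open>G\<close> maps into the open disc.\<close>

lemma cmod_le_of_Re_nonneg:
  assumes hol: "F holomorphic_on ball c r" and pos: "\<And>z. z \<in> ball c r \<Longrightarrow> Re (F z) \<ge> 0"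
    and "Im (F c) = 0" "r > 0" "dist c z \<le> r / 2"
  shows "cmod (F z) \<le> 3 * Re (F c)"
proof (rule field_le_epsilon)
  fix d :: real assume "d > 0"
  \<comment> \<open>The final bound is three times the shifted centre value plus one
    \<open>e\<close> for undoing the shift, so the total excess is \<open>4 * e = d\<close>.\<close>
  define e where "e = d / 4"
  have e: "e > 0" using \<open>d > 0\<close> by (simp add: e_def)
  have mem: "c + of_real r * w \<in> ball c r" if "cmod w < 1" for w
    using that \<open>r > 0\<close> by (simp add: dist_norm norm_mult)
  define A where "A = Re (F c) + e"
  have A: "A > 0" using pos[of c] e \<open>r > 0\<close> by (simp add: A_def)
  \<comment> \<open>The shifted function pulled back to the unit disc, with value \<open>A\<close>
    at 0, so that its Cayley transform \<open>G\<close> vanishes there.\<close>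
  define H where "H w = F (c + of_real r * w) + of_real e" for w
  define G where "G w = (H w - of_real A) / (H w + of_real A)" for w
  have ReH: "Re (H w) > 0" if "cmod w < 1" for w
    using pos[OF mem[OF that]] e by (simp add: H_def)
  have nz: "H w + of_real A \<noteq> 0" if "cmod w < 1" for w
    using ReH[OF that] A by (auto simp: complex_eq_iff)
  have H_hol: "H holomorphic_on ball 0 1"
  proof -
    have "(F \<circ> (\<lambda>w. c + of_real r * w)) holomorphic_on ball 0 1"
    proof (rule holomorphic_on_compose_gen[OF _ hol])
      show "(\<lambda>w. c + of_real r * w) holomorphic_on ball 0 1"
        by (intro holomorphic_intros)
      show "(\<lambda>w. c + of_real r * w) ` ball 0 1 \<subseteq> ball c r"
      proof (rule image_subsetI)
        fix w :: complex assume "w \<in> ball 0 1"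
        then show "c + of_real r * w \<in> ball c r" by (intro mem) simp
      qed
    qed
    then show ?thesis
      unfolding H_def[abs_def] by (intro holomorphic_intros) (simp add: o_def)
  qed
  have "G holomorphic_on ball 0 1"
    unfolding G_def[abs_def] using nz by (intro holomorphic_intros H_hol) auto
  moreover have "H 0 = of_real A"
    using assms(3) by (simp add: H_def A_def complex_eq_iff)
  then have "G 0 = 0" by (simp add: G_def)
  moreover have "cmod (G w) < 1" if "cmod w < 1" for w
  proof -
    have "(cmod (H w - of_real A))\<^sup>2 = (cmod (H w + of_real A))\<^sup>2 - 4 * A * Re (H w)"
      unfolding cmod_power2 by (simp add: power2_eq_square algebra_simps)
    also have "\<dots> < (cmod (H w + of_real A))\<^sup>2"
      using A ReH[OF that] by simp
    finally have "cmod (H w - of_real A) < cmod (H w + of_real A)"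
      by (rule power_less_imp_less_base) simp
    then show ?thesis
      using nz[OF that] by (simp add: G_def norm_divide divide_less_eq)
  qed
  moreover define w where "w = (z - c) / of_real r"
  moreover have w: "cmod w \<le> 1 / 2"
    using assms(4,5) by (simp add: w_def norm_divide dist_norm norm_minus_commute field_simps)
  ultimately have "cmod (G w) \<le> 1 / 2"
    using Schwarz_Lemma(1)[of G w] by fastforce
  \<comment> \<open>Undoing the Cayley transform: this gives
    \<open>cmod (H w) \<le> cmod (H w) / 2 + 3 * A / 2\<close>, which is solved for
    \<open>cmod (H w)\<close>.\<close>
  then have "cmod (H w - of_real A) \<le> cmod (H w + of_real A) / 2"
    using nz[of w] w by (simp add: G_def norm_divide divide_le_eq)
  also have "cmod (H w + of_real A) \<le> cmod (H w) + A"
    using norm_triangle_ineq[of "H w" "of_real A"] A by simp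
  finally have "cmod (H w - of_real A) \<le> cmod (H w) / 2 + A / 2"
    by simp
  moreover have "cmod (H w) \<le> cmod (H w - of_real A) + A"
    using norm_triangle_ineq[of "H w - of_real A" "of_real A"] A by simp
  ultimately have "cmod (H w) \<le> 3 * A" by linarith
  moreover have "F z = H w - of_real e"
    using \<open>r > 0\<close> by (simp add: H_def w_def)
  then have "cmod (F z) \<le> cmod (H w) + e"
    using norm_triangle_ineq4[of "H w" "of_real e"] e by simp
  ultimately show "cmod (F z) \<le> 3 * Re (F c) + d"
    by (simp add: A_def e_def)
qed

lemma Harnack_ball:
  assumes "harmonic_on (ball c r) u" "\<And>z. z \<in> ball c r \<Longrightarrow> u z \<ge> 0" "r > 0" "dist c z \<le> r / 2"
  shows "u z \<le> 3 * u c"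
proof -
  obtain F where F: "real_part_on (ball c r) u F" "Im (F (cpt c)) = 0"
    using harmonic_on_ball_imp_real_part assms by blast
  have "Re (F w) \<ge> 0" if "w \<in> ball (cpt c) r" for w
    using that F(1) assms(2) by (auto simp: real_part_on_def simp flip: cpt_image_ball)
  then have "cmod (F (cpt z)) \<le> 3 * Re (F (cpt c))"
    using F assms by (intro cmod_le_of_Re_nonneg[of _ _ r]) (auto simp: real_part_on_def cpt_image_ball dist_cpt)
  moreover have "u z = Re (F (cpt z))" "u c = Re (F (cpt c))"
    using F(1) assms(3,4) by (auto simp: real_part_on_def)
  ultimately show ?thesis
    using complex_Re_le_cmod[of "F (cpt z)"] by linarith
qed

text \<open>Comparability of values at two points, with a constant common to all nonnegative
  harmonic functions, is an equivalence relation. Harnack on discs makes its classes open, so a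
  connected \<open>D\<close> is a single class.\<close>

lemma Harnack_connected:
  assumes "open D" "connected D" "a \<in> D" "b \<in> D"
  shows "\<exists>C\<ge>0. \<forall>u. harmonic_on D u \<and> (\<forall>z\<in>D. u z \<ge> 0) \<longrightarrow> u b \<le> C * u a"
proof -
  \<comment> \<open>Both inequalities are included to make the relation symmetric.\<close>
  define R where "R a b \<longleftrightarrow> (\<exists>C\<ge>0. \<forall>u. harmonic_on D u \<and> (\<forall>z\<in>D. u z \<ge> 0) \<longrightarrow> u b \<le> C * u a \<and> u a \<le> C * u b)" for a b
  have "R a b"
  proof (rule connected_equivalence_relation[OF assms(2-4)])
    show "R y x" if "R x y" for x y
      using that unfolding R_def by blast
    show "R x z" if xy: "R x y" and yz: "R y z" for x y z
    proof -
      obtain C where C: "C \<ge> 0" "\<And>u. harmonic_on D u \<Longrightarrow> (\<forall>z\<in>D. u z \<ge> 0) \<Longrightarrow> u y \<le> C * u x \<and> u x \<le> C * u y"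
        using xy unfolding R_def by blast
      obtain C' where C': "C' \<ge> 0" "\<And>u. harmonic_on D u \<Longrightarrow> (\<forall>z\<in>D. u z \<ge> 0) \<Longrightarrow> u z \<le> C' * u y \<and> u y \<le> C' * u z"
        using yz unfolding R_def by blast
      have "u z \<le> C * C' * u x \<and> u x \<le> C * C' * u z" if u: "harmonic_on D u" "\<forall>z\<in>D. u z \<ge> 0" for u
      proof -
        have "u z \<le> C' * u y" "u x \<le> C * u y" "C' * u y \<le> C' * (C * u x)" "C * u y \<le> C * (C' * u z)"
          using C C' u by (auto intro: mult_left_mono)
        then show ?thesis by (simp add: mult_ac)
      qed
      then show ?thesis
        unfolding R_def using C(1) C'(1) by (intro exI[of _ "C * C'"]) auto
    qed
    show "\<exists>T. openin (top_of_set D) T \<and> z \<in> T \<and> (\<forall>x\<in>T. R z x)" if zD: "z \<in> D" for z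
    proof -
      obtain r where r: "r > 0" "ball z r \<subseteq> D" using openE[OF assms(1) zD] by blast
      \<comment> \<open>With the radius \<open>r / 4\<close>, the disc of radius
        \<open>r / 2\<close> about \<open>x\<close> stays in \<open>D\<close> and has
        \<open>z\<close> in its half disc, so Harnack also applies with \<open>x\<close> as
        centre.\<close>
      have "R z x" if x: "x \<in> ball z (r / 4)" for x
        unfolding R_def
      proof (intro exI[of _ 3] conjI allI impI; (elim conjE)?)
        fix u assume u: "harmonic_on D u" "\<forall>z\<in>D. 0 \<le> u z"
        show "u x \<le> 3 * u z"
          using r u x by (intro Harnack_ball[of z r] harmonic_on_subset[OF u(1)]) auto
        have "ball x (r / 2) \<subseteq> ball z r"
          using x r by (auto simp: ball_subset_ball_iff dist_commute)
        then have sub: "ball x (r / 2) \<subseteq> D" using r by blast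
        show "u z \<le> 3 * u x"
          using r u x sub by (intro Harnack_ball[of x "r / 2"] harmonic_on_subset[OF u(1)]) (auto simp: dist_commute)
      qed auto
      moreover have "openin (top_of_set D) (ball z (r / 4))"
        using r by (auto intro!: openin_open_eq[THEN iffD2] simp: assms(1) subset_iff)
      ultimately show ?thesis using r by (intro exI[of _ "ball z (r / 4)"]) auto
    qed
  qed
  then show ?thesis unfolding R_def by blast
qed

text \<open>Uniform closeness of the \<open>u n\<close> passes to the holomorphic functions
  \<open>F n\<close>, since a difference of real parts becomes nonnegative after adding its bound
  and all \<open>F n\<close> are real at the centre. The \<open>F n\<close> then converge uniformly
  on the half disc to a holomorphic function with real part \<open>v\<close>.\<close>

lemma harmonic_on_uniform_limit:
  assumes "r > 0" "\<And>n. harmonic_on (ball c r) (u n)"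
    and le: "\<And>n z. z \<in> ball c r \<Longrightarrow> \<bar>u n z - v z\<bar> \<le> e n" and e: "e \<longlonglongrightarrow> (0::real)"
  shows "harmonic_on (ball c (r / 2)) v"
proof -
  have "\<exists>F. real_part_on (ball c r) (u n) F \<and> Im (F (cpt c)) = 0" for n
    using harmonic_on_ball_imp_real_part[OF assms(2,1)] by metis
  then obtain F where F: "\<And>n. real_part_on (ball c r) (u n) (F n)" "\<And>n. Im (F n (cpt c)) = 0"
    by metis
  have hol: "F n holomorphic_on ball (cpt c) r" for n
    using F by (simp add: real_part_on_def cpt_image_ball)
  have e0: "e n \<ge> 0" for n
    using le[of c n] assms(1) by auto
  \<comment> \<open>The factor 7 is 3 times 2, from a shifted centre value of at most
    \<open>2 * d\<close>, plus 1 for removing the shift.\<close>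
  have Cauchy: "cmod (F n z - F m z) \<le> 7 * (e n + e m)" if z: "z \<in> cball (cpt c) (r / 2)" for n m z
  proof -
    define d where "d = e n + e m"
    have close: "\<bar>u n w - u m w\<bar> \<le> d" if "w \<in> ball c r" for w
      using le[OF that, of n] le[OF that, of m] by (simp add: d_def)
    let ?G = "\<lambda>z. F n z - F m z + of_real d"
    have Re: "Re (?G (cpt w)) = u n w - u m w + d" if "w \<in> ball c r" for w
      using F that by (simp add: real_part_on_def)
    have "cmod (?G z) \<le> 3 * Re (?G (cpt c))"
    proof (rule cmod_le_of_Re_nonneg[of ?G _ r])
      show "?G holomorphic_on ball (cpt c) r"
        by (intro holomorphic_intros hol)
      show "Re (?G w) \<ge> 0" if w: "w \<in> ball (cpt c) r" for w
      proof -
        obtain w' where "w = cpt w'" "w' \<in> ball c r"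
          using w by (metis cpt_image_ball image_iff)
        then show ?thesis using Re close by fastforce
      qed
    qed (use F assms z in auto)
    also have "Re (?G (cpt c)) \<le> 2 * d"
      using Re[of c] close[of c] assms(1) by simp
    finally have "cmod (?G z) \<le> 6 * d" by simp
    moreover have "d \<ge> 0" using e0 by (simp add: d_def)
    then have "cmod (F n z - F m z) \<le> cmod (?G z) + d"
      using norm_triangle_ineq4[of "?G z" "of_real d"] by simp
    ultimately show ?thesis unfolding d_def[symmetric] by linarith
  qed
  have "uniformly_Cauchy_on (cball (cpt c) (r / 2)) F"
  proof (rule uniformly_Cauchy_onI)
    fix d :: real assume "d > 0"
    then have "\<forall>\<^sub>F n in sequentially. e n < d / 14"
      using e by (intro order_tendstoD) auto
    then obtain M where M: "\<And>n. n \<ge> M \<Longrightarrow> e n < d / 14"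
      by (auto simp: eventually_sequentially)
    have "dist (F m z) (F n z) < d" if "z \<in> cball (cpt c) (r / 2)" "m \<ge> M" "n \<ge> M" for z m n
      using Cauchy[OF that(1), of m n] M[OF that(2)] M[OF that(3)] by (simp add: dist_norm)
    then show "\<exists>M. \<forall>z\<in>cball (cpt c) (r / 2). \<forall>m\<ge>M. \<forall>n\<ge>M. dist (F m z) (F n z) < d"
      by blast
  qed
  then obtain G where G: "uniform_limit (cball (cpt c) (r / 2)) F G sequentially"
    using Cauchy_uniformly_convergent uniformly_convergent_on_def by blast
  have "cball (cpt c) (r / 2) \<subseteq> ball (cpt c) r" using assms(1) by auto
  then have "continuous_on (cball (cpt c) (r / 2)) (F n) \<and> F n holomorphic_on ball (cpt c) (r / 2)" for n
    using hol[of n] by (meson ball_subset_cball dual_order.trans holomorphic_on_imp_continuous_on holomorphic_on_subset)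
  then have G_hol: "G holomorphic_on ball (cpt c) (r / 2)"
    using holomorphic_uniform_limit[OF always_eventually G] by auto
  have "v w = Re (G (cpt w))" if w: "w \<in> ball c (r / 2)" for w
  proof -
    have wr: "w \<in> ball c r" using w assms(1) by auto
    have "(\<lambda>n. F n (cpt w)) \<longlonglongrightarrow> G (cpt w)"
      using w by (intro tendsto_uniform_limitI[OF G]) (auto simp: dist_cpt)
    then have "(\<lambda>n. u n w) \<longlonglongrightarrow> Re (G (cpt w))"
      using F(1) wr tendsto_Re by (fastforce simp: real_part_on_def)
    moreover have "(\<lambda>n. u n w - v w) \<longlonglongrightarrow> 0"
      using le[OF wr] by (intro Lim_null_comparison[OF _ e]) auto
    then have "(\<lambda>n. u n w) \<longlonglongrightarrow> v w" by (simp add: LIM_zero_iff)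
    ultimately show ?thesis by (rule LIMSEQ_unique[symmetric])
  qed
  with G_hol have "real_part_on (ball c (r / 2)) v G"
    by (simp add: real_part_on_def cpt_image_ball)
  then show ?thesis by (rule harmonic_on_real_part)
qed

section \<open>Maximum principle\<close>

text \<open>If \<open>l\<close> were positive, \<open>f'\<close>, which vanishes at the maximum,
  would be positive just to the right of \<open>a\<close>, and \<open>f\<close> would exceed
  \<open>f a\<close> there.\<close>

lemma second_deriv_nonpos_at_local_max:
  fixes f :: "real \<Rightarrow> real"
  assumes "d > 0" and f: "\<And>t. \<bar>t - a\<bar> < d \<Longrightarrow> (f has_real_derivative f' t) (at t)"
    and f': "(f' has_real_derivative l) (at a)" and le: "\<And>t. \<bar>t - a\<bar> < d \<Longrightarrow> f t \<le> f a"
  shows "l \<le> 0"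
proof (rule ccontr)
  assume "\<not> l \<le> 0"
  then obtain k where k: "k > 0" "\<And>h. h > 0 \<Longrightarrow> h < k \<Longrightarrow> f' a < f' (a + h)"
    using DERIV_pos_inc_right[OF f'] by auto
  have f'a: "f' a = 0"
    using assms(1) le by (intro DERIV_local_max[OF f[of a], of d]) (auto simp: abs_minus_commute)
  define h where "h = min d k / 2"
  have h: "0 < h" "h < d" "h < k" using assms(1) k(1) by (auto simp: h_def)
  have "\<exists>z. a < z \<and> z < a + h \<and> f (a + h) - f a = (a + h - a) * f' z"
    using h by (intro MVT2 f) auto
  then obtain z where z: "a < z" "z < a + h" "f (a + h) - f a = h * f' z" by auto
  have "f' z > 0" using k(2)[of "z - a"] z h f'a by simp
  then have "f (a + h) > f a" using z(3) h(1) by (metis diff_gt_0_iff_gt mult_pos_pos)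
  then show False using le[of "a + h"] h by simp
qed

text \<open>Adding a small multiple of \<open>\<bar>z\<bar>\<^sup>2\<close> makes the Laplacian strictly positive, which excludes interior maxima.\<close>

lemma harmonic_max_principle:
  assumes "bounded D" "harmonic_on D u" "continuous_on (closure D) u"
    and le: "\<And>z. z \<in> frontier D \<Longrightarrow> u z \<le> k" and y: "y \<in> D"
  shows "u y \<le> k"
proof (rule ccontr)
  assume "\<not> u y \<le> k"
  then have uy: "u y > k" by simp
  have op: "open D" and pe: "partials_exist_on D u" "partials_exist_on D (d1 u)" "partials_exist_on D (d2 u)"
    and lap: "\<And>z. z \<in> D \<Longrightarrow> d1 (d1 u) z + d2 (d2 u) z = 0"
    using assms(2) by (auto simp: harmonic_on_def C2_on_def laplacian_def)
  obtain R where R: "R > 0" "\<And>z. z \<in> closure D \<Longrightarrow> norm z \<le> R"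
    using bounded_closure[OF assms(1)] unfolding bounded_pos by blast
  \<comment> \<open>The perturbation is at most \<open>(u y - k) / 2\<close> on the closure, so
    \<open>w\<close> stays below \<open>u y\<close> on the frontier and its maximum must lie
    inside.\<close>
  define e where "e = (u y - k) / (2 * R\<^sup>2)"
  have e: "e > 0" using uy R by (simp add: e_def)
  define w where "w z = u z + e * ((fst z)\<^sup>2 + (snd z)\<^sup>2)" for z
  have "continuous_on (closure D) w"
    unfolding w_def[abs_def] using assms(3) by (intro continuous_intros)
  moreover have "compact (closure D)" "closure D \<noteq> {}"
    using assms(1) y by (auto simp: compact_closure)
  ultimately obtain p where p: "p \<in> closure D" "\<And>z. z \<in> closure D \<Longrightarrow> w z \<le> w p"
    using continuous_attains_sup by metis
  have "w p \<ge> w y" using p y closure_subset by blast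
  moreover have "w y \<ge> u y" using e by (simp add: w_def)
  ultimately have wp: "w p \<ge> u y" by simp
  have "p \<in> D"
  proof (rule ccontr)
    assume "p \<notin> D"
    then have "u p \<le> k" using p op by (intro le) (auto simp: frontier_def interior_open)
    moreover have "(fst p)\<^sup>2 + (snd p)\<^sup>2 = (norm p)\<^sup>2"
      by (simp add: norm_prod_def)
    then have "w p = u p + e * (norm p)\<^sup>2" by (simp add: w_def)
    moreover have "e * (norm p)\<^sup>2 \<le> e * R\<^sup>2"
      using R(2)[OF p(1)] e by (simp add: power_mono)
    moreover have "e * R\<^sup>2 = (u y - k) / 2" using R by (simp add: e_def)
    ultimately show False using wp uy by argo
  qed
  obtain a b where ab: "p = (a, b)" by fastforce
  obtain r where r: "r > 0" "ball p r \<subseteq> D" using openE[OF op \<open>p \<in> D\<close>] by blast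
  have mem: "(t, b) \<in> D" if "\<bar>t - a\<bar> < r" for t
    using that r by (auto simp: ab dist_Pair_Pair dist_real_def abs_minus_commute subset_iff)
  have mem': "(a, t) \<in> D" if "\<bar>t - b\<bar> < r" for t
    using that r by (auto simp: ab dist_Pair_Pair dist_real_def abs_minus_commute subset_iff)
  have pD: "(a, b) \<in> D" using \<open>p \<in> D\<close> ab by simp
  have max: "w z \<le> w (a, b)" if "z \<in> D" for z
    using p(2)[of z] that closure_subset ab by blast
  \<comment> \<open>The two one-dimensional second derivative tests for \<open>w\<close> at the
    maximum add up to \<open>4 * e \<le> 0\<close>, because the Laplacian of \<open>u\<close>
    vanishes.\<close>
  have "d1 (d1 u) (a, b) + 2 * e \<le> 0"
  proof (rule second_deriv_nonpos_at_local_max[where f = "\<lambda>t. w (t, b)" and f' = "\<lambda>t. d1 u (t, b) + 2 * e * t"])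
    show "((\<lambda>t. w (t, b)) has_real_derivative d1 u (t, b) + 2 * e * t) (at t)" if "\<bar>t - a\<bar> < r" for t
      unfolding w_def by (auto intro!: derivative_eq_intros partials_exist_onD(1)[OF pe(1)] mem that)
    show "((\<lambda>t. d1 u (t, b) + 2 * e * t) has_real_derivative d1 (d1 u) (a, b) + 2 * e) (at a)"
      by (auto intro!: derivative_eq_intros partials_exist_onD(1)[OF pe(2)] pD)
  qed (use r max mem in auto)
  moreover have "d2 (d2 u) (a, b) + 2 * e \<le> 0"
  proof (rule second_deriv_nonpos_at_local_max[where f = "\<lambda>t. w (a, t)" and f' = "\<lambda>t. d2 u (a, t) + 2 * e * t"])
    show "((\<lambda>t. w (a, t)) has_real_derivative d2 u (a, t) + 2 * e * t) (at t)" if "\<bar>t - b\<bar> < r" for t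
      unfolding w_def by (auto intro!: derivative_eq_intros partials_exist_onD(2)[OF pe(1)] mem' that)
    show "((\<lambda>t. d2 u (a, t) + 2 * e * t) has_real_derivative d2 (d2 u) (a, b) + 2 * e) (at b)"
      by (auto intro!: derivative_eq_intros partials_exist_onD(2)[OF pe(3)] pD)
  qed (use r max mem' in auto)
  ultimately show False using lap[OF pD] e by linarith
qed

section \<open>The Daniell extension of the Dirichlet functional\<close>

text \<open>Otherwise points with \<open>k n (z n) \<le> c\<close> accumulate at some
  \<open>l\<close>; monotonicity in \<open>n\<close> and continuity of each \<open>k m\<close> force
  \<open>k m l \<le> c\<close> for all \<open>m\<close>. This one-sided form of Dini's theorem
  allows an infinite or discontinuous limit.\<close>

lemma Dini_lower_bound:
  fixes k :: "nat \<Rightarrow> 'a::metric_space \<Rightarrow> real"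
  assumes "compact B" "\<And>n. continuous_on B (k n)" "\<And>z. z \<in> B \<Longrightarrow> incseq (\<lambda>n. k n z)"
    and "\<And>z. z \<in> B \<Longrightarrow> \<exists>n. k n z > c"
  shows "\<exists>n. \<forall>z\<in>B. k n z > c"
proof (rule ccontr)
  assume "\<nexists>n. \<forall>z\<in>B. k n z > c"
  then have "\<forall>n. \<exists>z\<in>B. k n z \<le> c" by (meson not_less)
  then obtain z where z: "\<And>n. z n \<in> B" "\<And>n. k n (z n) \<le> c" by metis
  obtain l s where ls: "l \<in> B" "strict_mono s" "(\<lambda>n. z (s n)) \<longlonglongrightarrow> l"
    using assms(1) z(1) unfolding compact_def o_def by metis
  have "k m l \<le> c" for m
  proof (rule LIMSEQ_le_const2)
    show "(\<lambda>n. k m (z (s n))) \<longlonglongrightarrow> k m l"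
      using ls z(1) by (intro continuous_on_tendsto_compose[OF assms(2)]) auto
    have "k m (z (s n)) \<le> c" if "n \<ge> m" for n
    proof -
      have "m \<le> s n" using that seq_suble[OF ls(2), of n] by simp
      then have "k m (z (s n)) \<le> k (s n) (z (s n))"
        using incseqD[OF assms(3)[OF z(1)]] by blast
      then show ?thesis using z(2)[of "s n"] by simp
    qed
    then show "\<exists>N. \<forall>n\<ge>N. k m (z (s n)) \<le> c" by auto
  qed
  then show False using assms(4)[OF ls(1)] by (meson not_less)
qed

lemma approx_seqD:
  assumes "approx_seq B g \<phi>"
  shows "continuous_on B (g n)"
    and "z \<in> B \<Longrightarrow> incseq (\<lambda>n. g n z)"
    and "z \<in> B \<Longrightarrow> (\<lambda>n. ereal (g n z)) \<longlonglongrightarrow> \<phi> z"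
    and "z \<in> B \<Longrightarrow> ereal (g n z) \<le> \<phi> z"
    and "z \<in> B \<Longrightarrow> \<phi> z \<noteq> -\<infinity>"
proof -
  show 1: "continuous_on B (g n)" "z \<in> B \<Longrightarrow> incseq (\<lambda>n. g n z)"
     "z \<in> B \<Longrightarrow> (\<lambda>n. ereal (g n z)) \<longlonglongrightarrow> \<phi> z"
    using assms by (auto simp: approx_seq_def intro: incseq_SucI)
  show "ereal (g n z) \<le> \<phi> z" if "z \<in> B" for n
  proof (rule incseq_le[OF _ 1(3)[OF that]])
    show "incseq (\<lambda>n. ereal (g n z))" using 1(2)[OF that] by (simp add: incseq_def)
  qed
  from this[of 0] show "z \<in> B \<Longrightarrow> \<phi> z \<noteq> -\<infinity>" by auto
qed

text \<open>If \<open>a\<close> is infinite, one of \<open>p\<close> and \<open>q\<close> is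
  \<infinity>; excluding -\<infinity> for the other keeps the sum equal to \<infinity>.\<close>

lemma ereal_add_nonneg_sandwich:
  fixes a :: ereal
  assumes "a \<le> p" "- a \<le> q" "p \<noteq> -\<infinity>" "q \<noteq> -\<infinity>"
  shows "0 \<le> p + q"
  using assms by (cases a; cases p; cases q) auto

section \<open>The Dirichlet functional and its extension to increasing limits\<close>

locale dirichlet_domain =
  fixes D :: "pt set"
  assumes bdd: "bounded D" and op: "open D" and conn: "connected D"
    and solvable: "\<And>g. continuous_on (frontier D) g \<Longrightarrow>
      \<exists>u. harmonic_on D u \<and> continuous_on (closure D) u \<and> (\<forall>z\<in>frontier D. u z = g z)"
begin

lemma compact_frontier: "compact (frontier D)"
  using bdd by (simp add: compact_frontier_bounded)

lemma dirichlet_sol: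
  assumes "continuous_on (frontier D) g"
  shows "harmonic_on D (dirichlet_sol D g)" "continuous_on (closure D) (dirichlet_sol D g)"
    and "z \<in> frontier D \<Longrightarrow> dirichlet_sol D g z = g z"
  using someI_ex[OF solvable[OF assms], folded dirichlet_sol_def] by simp_all

text \<open>The maximum principle for the difference of the two solutions. The case
  \<open>c = 0\<close> is monotonicity; a small \<open>c\<close> absorbs the error left by Dini's
  argument.\<close>

lemma Ix_le:
  assumes g: "continuous_on (frontier D) g" and h: "continuous_on (frontier D) h"
    and "\<And>z. z \<in> frontier D \<Longrightarrow> g z \<le> h z + c" "y \<in> D"
  shows "Ix D y g \<le> Ix D y h + c"
proof -
  have "dirichlet_sol D g y - dirichlet_sol D h y \<le> c"
  proof (rule harmonic_max_principle[OF bdd _ _ _ \<open>y \<in> D\<close>])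
    show "harmonic_on D (\<lambda>z. dirichlet_sol D g z - dirichlet_sol D h z)"
      by (intro harmonic_on_diff dirichlet_sol(1) g h)
    show "continuous_on (closure D) (\<lambda>z. dirichlet_sol D g z - dirichlet_sol D h z)"
      by (intro continuous_on_diff dirichlet_sol(2) g h)
    show "dirichlet_sol D g z - dirichlet_sol D h z \<le> c" if "z \<in> frontier D" for z
      using assms(3)[OF that] dirichlet_sol(3)[OF g that] dirichlet_sol(3)[OF h that] by simp
  qed
  then show ?thesis by (simp add: Ix_def)
qed

text \<open>The maximum principle for the negated sum of the two solutions.\<close>

lemma Ix_add_ge:
  assumes g: "continuous_on (frontier D) g" and h: "continuous_on (frontier D) h"
    and "\<And>z. z \<in> frontier D \<Longrightarrow> c \<le> g z + h z" "y \<in> D"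
  shows "c \<le> Ix D y g + Ix D y h"
proof -
  have "0 - (dirichlet_sol D g y + dirichlet_sol D h y) \<le> - c"
  proof (rule harmonic_max_principle[OF bdd _ _ _ \<open>y \<in> D\<close>])
    show "harmonic_on D (\<lambda>z. 0 - (dirichlet_sol D g z + dirichlet_sol D h z))"
      by (intro harmonic_on_diff harmonic_on_const harmonic_on_add dirichlet_sol(1) g h op)
    show "continuous_on (closure D) (\<lambda>z. 0 - (dirichlet_sol D g z + dirichlet_sol D h z))"
      by (intro continuous_on_diff continuous_on_const continuous_on_add dirichlet_sol(2) g h)
    show "0 - (dirichlet_sol D g z + dirichlet_sol D h z) \<le> - c" if "z \<in> frontier D" for z
      using assms(3)[OF that] dirichlet_sol(3)[OF g that] dirichlet_sol(3)[OF h that] by simp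
  qed
  then show ?thesis by (simp add: Ix_def)
qed

lemma harmonic_on_Ix:
  assumes "continuous_on (frontier D) g"
  shows "harmonic_on D (\<lambda>y. Ix D y g)"
  using dirichlet_sol(1)[OF assms] by (simp add: Ix_def)

lemma incseq_Ix:
  assumes "approx_seq (frontier D) g \<phi>" "y \<in> D"
  shows "incseq (\<lambda>n. Ix D y (g n))"
proof (rule incseq_SucI)
  show "Ix D y (g n) \<le> Ix D y (g (Suc n))" for n
    using Ix_le[OF approx_seqD(1,1)[OF assms(1)], of n "Suc n" 0] assms
    by (auto simp: approx_seq_def)
qed

text \<open>For fixed \<open>m\<close> the limit of the \<open>h n\<close> is at least
  \<open>g m\<close>, so Dini yields some \<open>h n\<close> above \<open>g m - e\<close> on the
  whole frontier. Exchanging the two sequences shows that the limit of the integrals depends on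
  \<phi> alone.\<close>

lemma Ix_limit_le:
  assumes g: "approx_seq (frontier D) g \<phi>" and h: "approx_seq (frontier D) h \<phi>" and y: "y \<in> D"
    and L: "(\<lambda>n. ereal (Ix D y (g n))) \<longlonglongrightarrow> L" and M: "(\<lambda>n. ereal (Ix D y (h n))) \<longlonglongrightarrow> M"
  shows "L \<le> M"
proof (rule LIMSEQ_le_const2[OF L], intro exI allI impI)
  fix m
  have hM: "ereal (Ix D y (h n)) \<le> M" for n
    using incseq_Ix[OF h y] by (intro incseq_le[OF _ M]) (simp add: incseq_def)
  show "ereal (Ix D y (g m)) \<le> M"
  proof (rule ereal_le_epsilon2)
    fix e :: real assume e: "e > 0"
    have "\<exists>n. \<forall>z\<in>frontier D. h n z - g m z > - e"
    proof (rule Dini_lower_bound[OF compact_frontier])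
      show "continuous_on (frontier D) (\<lambda>z. h n z - g m z)" for n
        by (intro continuous_intros approx_seqD(1)[OF g] approx_seqD(1)[OF h])
      fix z assume z: "z \<in> frontier D"
      show "incseq (\<lambda>n. h n z - g m z)"
        using approx_seqD(2)[OF h z] by (simp add: incseq_def)
      have "ereal (g m z - e) < ereal (g m z)" using e by simp
      also have "\<dots> \<le> \<phi> z" using approx_seqD(4)[OF g z] .
      finally have "\<forall>\<^sub>F n in sequentially. ereal (g m z - e) < ereal (h n z)"
        by (intro order_tendstoD(1)[OF approx_seqD(3)[OF h z]])
      then obtain n where "g m z - e < h n z"
        by (auto simp: eventually_sequentially)
      then show "\<exists>n. h n z - g m z > - e" by (intro exI[of _ n]) simp
    qed
    then obtain n where n: "\<And>z. z \<in> frontier D \<Longrightarrow> h n z - g m z > - e" by blast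
    have "Ix D y (g m) \<le> Ix D y (h n) + e"
      using n by (intro Ix_le approx_seqD(1)[OF g] approx_seqD(1)[OF h] y) (smt (verit))
    then have "ereal (Ix D y (g m)) \<le> ereal (Ix D y (h n)) + ereal e" by simp
    also have "\<dots> \<le> M + ereal e" by (intro add_right_mono hM)
    finally show "ereal (Ix D y (g m)) \<le> M + ereal e" .
  qed
qed

text \<open>The limit along \<open>g\<close> exists by monotonicity, so the value chosen in
  \<open>I1\<close> is attained along some sequence \<open>h\<close>; comparing \<open>g\<close> and
  \<open>h\<close> in both directions identifies it with the limit along \<open>g\<close>.\<close>

lemma Ix_tendsto_I1:
  assumes g: "approx_seq (frontier D) g \<phi>" and y: "y \<in> D"
  shows "(\<lambda>n. ereal (Ix D y (g n))) \<longlonglongrightarrow> I1 (frontier D) (Ix D y) \<phi>"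
proof -
  let ?P = "\<lambda>L. \<exists>g. approx_seq (frontier D) g \<phi> \<and> (\<lambda>n. ereal (Ix D y (g n))) \<longlonglongrightarrow> L"
  have inc: "incseq (\<lambda>n. ereal (Ix D y (g n)))"
    using incseq_Ix[OF g y] by (simp add: incseq_def)
  note L = LIMSEQ_SUP[OF inc]
  then have "?P (I1 (frontier D) (Ix D y) \<phi>)"
    unfolding I1_def using g by (intro someI_ex[of ?P]) blast
  then obtain h where h: "approx_seq (frontier D) h \<phi>"
    "(\<lambda>n. ereal (Ix D y (h n))) \<longlonglongrightarrow> I1 (frontier D) (Ix D y) \<phi>" by blast
  have "(SUP n. ereal (Ix D y (g n))) = I1 (frontier D) (Ix D y) \<phi>"
    using Ix_limit_le[OF g h(1) y L h(2)] Ix_limit_le[OF h(1) g y h(2) L] by (rule antisym)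
  then show ?thesis using L by simp
qed

lemma Ix_le_I1:
  assumes "approx_seq (frontier D) g \<phi>" "y \<in> D"
  shows "ereal (Ix D y (g n)) \<le> I1 (frontier D) (Ix D y) \<phi>"
  using incseq_Ix[OF assms] by (intro incseq_le[OF _ Ix_tendsto_I1[OF assms]]) (simp add: incseq_def)

text \<open>Dini puts some \<open>g n + h n\<close> above \<open>- e\<close> on the whole frontier.
  This is what keeps the lower integral below the upper one.\<close>

lemma I1_add_nonneg:
  assumes "\<phi> \<in> T1 (frontier D)" "\<psi> \<in> T1 (frontier D)" "y \<in> D"
    and nonneg: "\<And>z. z \<in> frontier D \<Longrightarrow> 0 \<le> \<phi> z + \<psi> z"
  shows "0 \<le> I1 (frontier D) (Ix D y) \<phi> + I1 (frontier D) (Ix D y) \<psi>"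
proof (rule ereal_le_epsilon2)
  fix e :: real assume e: "e > 0"
  obtain g h where g: "approx_seq (frontier D) g \<phi>" and h: "approx_seq (frontier D) h \<psi>"
    using assms(1,2) by (auto simp: T1_def)
  have "\<exists>n. \<forall>z\<in>frontier D. g n z + h n z > - e"
  proof (rule Dini_lower_bound[OF compact_frontier])
    show "continuous_on (frontier D) (\<lambda>z. g n z + h n z)" for n
      by (intro continuous_intros approx_seqD(1)[OF g] approx_seqD(1)[OF h])
    fix z assume z: "z \<in> frontier D"
    show "incseq (\<lambda>n. g n z + h n z)"
      using approx_seqD(2)[OF g z] approx_seqD(2)[OF h z] by (simp add: incseq_def add_mono)
    have "(\<lambda>n. ereal (g n z) + ereal (h n z)) \<longlonglongrightarrow> \<phi> z + \<psi> z"
      using approx_seqD(5)[OF g z] approx_seqD(5)[OF h z]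
      by (intro tendsto_add_ereal_general approx_seqD(3)[OF g z] approx_seqD(3)[OF h z]) auto
    moreover have "ereal (- e) < \<phi> z + \<psi> z"
      using e by (intro less_le_trans[OF _ nonneg[OF z]]) simp
    ultimately have "\<forall>\<^sub>F n in sequentially. ereal (- e) < ereal (g n z) + ereal (h n z)"
      by (rule order_tendstoD(1))
    then show "\<exists>n. g n z + h n z > - e"
      by (auto simp: eventually_sequentially)
  qed
  then obtain n where n: "\<And>z. z \<in> frontier D \<Longrightarrow> g n z + h n z > - e" by blast
  have "- e \<le> Ix D y (g n) + Ix D y (h n)"
    using n by (intro Ix_add_ge approx_seqD(1)[OF g] approx_seqD(1)[OF h] assms) (simp add: less_imp_le)
  then have "0 \<le> ereal (Ix D y (g n)) + ereal (Ix D y (h n)) + ereal e" by simp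
  also have "\<dots> \<le> I1 (frontier D) (Ix D y) \<phi> + I1 (frontier D) (Ix D y) \<psi> + ereal e"
    by (intro add_mono Ix_le_I1[OF g] Ix_le_I1[OF h] assms order_refl)
  finally show "0 \<le> I1 (frontier D) (Ix D y) \<phi> + I1 (frontier D) (Ix D y) \<psi> + ereal e" .
qed

section \<open>Dependence of the integrals on the base point\<close>

text \<open>Harnack's principle for increasing sequences: the increments \<open>u m - u n\<close>
  are nonnegative harmonic functions, so control at one point gives boundedness throughout
  \<open>D\<close> and a uniform rate of convergence on small discs.\<close>

lemma I1_finite_imp_harmonic:
  assumes "\<phi> \<in> T1 (frontier D)" "x \<in> D" "I1 (frontier D) (Ix D x) \<phi> < \<infinity>"
  obtains w where "harmonic_on D w" "\<And>y. y \<in> D \<Longrightarrow> I1 (frontier D) (Ix D y) \<phi> = ereal (w y)"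
proof -
  obtain g where g: "approx_seq (frontier D) g \<phi>" using assms(1) by (auto simp: T1_def)
  define u where "u n y = Ix D y (g n)" for n y
  have u: "harmonic_on D (u n)" for n
    unfolding u_def[abs_def] by (intro harmonic_on_Ix approx_seqD(1)[OF g])
  have inc: "incseq (\<lambda>n. u n y)" if "y \<in> D" for y
    using incseq_Ix[OF g that] by (simp add: u_def)
  have diff: "harmonic_on D (\<lambda>y. u m y - u n y)" "\<forall>y\<in>D. 0 \<le> u m y - u n y" if "n \<le> m" for n m
    using that u inc by (auto intro: harmonic_on_diff dest: incseqD)
  have "I1 (frontier D) (Ix D x) \<phi> \<noteq> -\<infinity>"
    using Ix_le_I1[OF g assms(2), of 0] by auto
  then obtain K where "I1 (frontier D) (Ix D x) \<phi> = ereal K"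
    using assms(3) by (cases "I1 (frontier D) (Ix D x) \<phi>") auto
  then have K: "u n x \<le> K" for n
    using Ix_le_I1[OF g assms(2), of n] by (simp add: u_def)
  have "\<exists>L. (\<lambda>n. u n y) \<longlonglongrightarrow> L" if y: "y \<in> D" for y
  proof -
    obtain C where C: "C \<ge> 0" "\<And>v. harmonic_on D v \<Longrightarrow> (\<forall>z\<in>D. v z \<ge> 0) \<Longrightarrow> v y \<le> C * v x"
      using Harnack_connected[OF op conn assms(2) y] by blast
    have "u n y \<le> u 0 y + C * (K - u 0 x)" for n
    proof -
      have "u n y - u 0 y \<le> C * (u n x - u 0 x)"
        using C(2) diff[of 0 n] by blast
      also have "\<dots> \<le> C * (K - u 0 x)"
        using C(1) K by (intro mult_left_mono) auto
      finally show ?thesis by simp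
    qed
    then show ?thesis using incseq_convergent[OF inc[OF y]] by blast
  qed
  then obtain w where w: "\<And>y. y \<in> D \<Longrightarrow> (\<lambda>n. u n y) \<longlonglongrightarrow> w y" by metis
  have uw: "u n y \<le> w y" if "y \<in> D" for n y
    using inc[OF that] w[OF that] by (rule incseq_le)
  have "harmonic_on D w"
  proof (rule harmonic_on_local[OF op])
    fix z assume z: "z \<in> D"
    obtain r where r: "r > 0" "ball z r \<subseteq> D" using openE[OF op z] by blast
    \<comment> \<open>Harnack costs one halving of the radius and the uniform limit theorem
      another.\<close>
    have "harmonic_on (ball z (r / 2 / 2)) w"
    proof (rule harmonic_on_uniform_limit[where u = u and e = "\<lambda>n. 3 * (w z - u n z)"])
      show "harmonic_on (ball z (r / 2)) (u n)" for n
        using r by (intro harmonic_on_subset[OF u]) auto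
      have "(\<lambda>n. 3 * (w z - u n z)) \<longlonglongrightarrow> 3 * (w z - w z)"
        by (intro tendsto_intros w z)
      then show "(\<lambda>n. 3 * (w z - u n z)) \<longlonglongrightarrow> 0" by simp
      fix n y assume y: "y \<in> ball z (r / 2)"
      have yD: "y \<in> D" using y r by auto
      \<comment> \<open>Harnack on the disc for \<open>u m - u n\<close>, in the limit of large
        \<open>m\<close>.\<close>
      have "w y - u n y \<le> 3 * (w z - u n z)"
      proof (rule LIMSEQ_le)
        show "(\<lambda>m. u m y - u n y) \<longlonglongrightarrow> w y - u n y" "(\<lambda>m. 3 * (u m z - u n z)) \<longlonglongrightarrow> 3 * (w z - u n z)"
          by (intro tendsto_intros w yD z)+
        have "u m y - u n y \<le> 3 * (u m z - u n z)" if "n \<le> m" for m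
          using diff[OF that] r y
          by (intro Harnack_ball[where u = "\<lambda>y. u m y - u n y" and r = r] harmonic_on_subset[OF diff(1)[OF that]]) auto
        then show "\<exists>N. \<forall>m\<ge>N. u m y - u n y \<le> 3 * (u m z - u n z)" by blast
      qed
      then show "\<bar>u n y - w y\<bar> \<le> 3 * (w z - u n z)"
        using uw[OF yD, of n] by simp
    qed (use r in simp)
    then show "\<exists>r>0. ball z r \<subseteq> D \<and> harmonic_on (ball z r) w"
      using r by (intro exI[of _ "r / 2 / 2"]) auto
  qed
  moreover have "I1 (frontier D) (Ix D y) \<phi> = ereal (w y)" if "y \<in> D" for y
    using Ix_tendsto_I1[OF g that] w[OF that]
    by (intro LIMSEQ_unique[of "\<lambda>n. ereal (u n y)"]) (auto simp: u_def)
  ultimately show thesis by (rule that)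
qed

text \<open>The upper bound holds because \<phi> itself competes in the infimum. For the lower one,
  every competitor has a nonnegative sum with \<psi>, so its integral is at least
  \<open>- b\<close>.\<close>

lemma upper_int_bounds:
  assumes "\<phi> \<in> T1 (frontier D)" "\<psi> \<in> T1 (frontier D)" "y \<in> D"
    and "\<And>z. z \<in> frontier D \<Longrightarrow> f z \<le> \<phi> z" "\<And>z. z \<in> frontier D \<Longrightarrow> - f z \<le> \<psi> z"
    and "I1 (frontier D) (Ix D y) \<phi> = ereal a" "I1 (frontier D) (Ix D y) \<psi> = ereal b"
  shows "ereal (- b) \<le> upper_int (frontier D) (Ix D y) f" "upper_int (frontier D) (Ix D y) f \<le> ereal a"
proof -
  show "upper_int (frontier D) (Ix D y) f \<le> ereal a"
    unfolding upper_int_def using assms by (intro Inf_lower) (auto simp flip: assms(6))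
  show "ereal (- b) \<le> upper_int (frontier D) (Ix D y) f"
    unfolding upper_int_def
  proof (rule Inf_greatest, safe)
    fix \<phi>' assume \<phi>': "\<phi>' \<in> T1 (frontier D)" "\<forall>x\<in>frontier D. f x \<le> \<phi>' x"
    have "0 \<le> I1 (frontier D) (Ix D y) \<phi>' + I1 (frontier D) (Ix D y) \<psi>"
    proof (rule I1_add_nonneg[OF \<phi>'(1) assms(2,3)])
      fix z assume z: "z \<in> frontier D"
      then have "\<phi>' z \<noteq> -\<infinity>" "\<psi> z \<noteq> -\<infinity>"
        using \<phi>'(1) assms(2) approx_seqD(5) unfolding T1_def by blast+
      then show "0 \<le> \<phi>' z + \<psi> z"
        using \<phi>'(2) assms(5) z by (intro ereal_add_nonneg_sandwich[of "f z"]) auto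
    qed
    then show "ereal (- b) \<le> I1 (frontier D) (Ix D y) \<phi>'"
      unfolding assms(7) by (cases "I1 (frontier D) (Ix D y) \<phi>'") auto
  qed
qed

text \<open>Majorants of \<open>f\<close> and \<open>- f\<close> that are nearly optimal at
  \<open>x\<close> have finite integrals there, hence harmonic integrals on all of \<open>D\<close>.
  The same pair then bounds the upper integrals at every \<open>y\<close>, although its gap is known
  to be small only at \<open>x\<close>.\<close>

lemma harmonic_sandwich:
  assumes "x \<in> D" "f \<in> daniell_L (frontier D) (Ix D x)" "e > 0"
  shows "\<exists>w l. harmonic_on D w \<and> harmonic_on D l \<and> w x + l x < e \<and>
    (\<forall>y\<in>D. ereal (- l y) \<le> upper_int (frontier D) (Ix D y) f \<and>
           upper_int (frontier D) (Ix D y) f \<le> ereal (w y) \<and>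
           ereal (- w y) \<le> upper_int (frontier D) (Ix D y) (\<lambda>z. - f z) \<and>
           upper_int (frontier D) (Ix D y) (\<lambda>z. - f z) \<le> ereal (l y))"
proof -
  let ?U = "upper_int (frontier D) (Ix D x)" and ?I = "\<lambda>y. I1 (frontier D) (Ix D y)"
  have eq: "?U f = - ?U (\<lambda>z. - f z)" and fin: "\<bar>?U f\<bar> \<noteq> \<infinity>"
    using assms(2) by (auto simp: daniell_L_def lower_int_def)
  obtain J where J: "?U f = ereal J" using fin by auto
  then have J': "?U (\<lambda>z. - f z) = ereal (- J)"
    using eq by (metis ereal_uminus_uminus uminus_ereal.simps(1))
  have "?U f < ereal (J + e / 2)" using J assms(3) by simp
  then obtain \<phi> where \<phi>: "\<phi> \<in> T1 (frontier D)" "\<And>z. z \<in> frontier D \<Longrightarrow> f z \<le> \<phi> z" "?I x \<phi> < ereal (J + e / 2)"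
    unfolding upper_int_def Inf_less_iff by blast
  have "?U (\<lambda>z. - f z) < ereal (- J + e / 2)" using J' assms(3) by simp
  then obtain \<psi> where \<psi>: "\<psi> \<in> T1 (frontier D)" "\<And>z. z \<in> frontier D \<Longrightarrow> - f z \<le> \<psi> z" "?I x \<psi> < ereal (- J + e / 2)"
    unfolding upper_int_def Inf_less_iff by blast
  have "?I x \<phi> < \<infinity>" "?I x \<psi> < \<infinity>"
    using \<phi>(3) \<psi>(3) by auto
  then obtain w l where w: "harmonic_on D w" "\<And>y. y \<in> D \<Longrightarrow> ?I y \<phi> = ereal (w y)"
    and l: "harmonic_on D l" "\<And>y. y \<in> D \<Longrightarrow> ?I y \<psi> = ereal (l y)"
    using I1_finite_imp_harmonic[OF \<phi>(1) assms(1)] I1_finite_imp_harmonic[OF \<psi>(1) assms(1)] by metis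
  have "w x < J + e / 2" "l x < - J + e / 2"
    using \<phi>(3) \<psi>(3) w(2) l(2) assms(1) by auto
  then have "w x + l x < e" by simp
  then show ?thesis
    using w l upper_int_bounds[OF \<phi>(1) \<psi>(1) _ \<phi>(2) \<psi>(2) w(2) l(2)]
      upper_int_bounds[OF \<psi>(1) \<phi>(1) _ \<psi>(2) _ l(2) w(2)] \<phi>(2)
    by (intro exI[of _ w] exI[of _ l]) auto
qed

lemma daniell_L_harmonic:
  assumes x: "x \<in> D" and f: "f \<in> daniell_L (frontier D) (Ix D x)"
  shows "\<forall>y\<in>D. f \<in> daniell_L (frontier D) (Ix D y)"
    and "harmonic_on D (\<lambda>y. daniell_int (frontier D) (Ix D y) f)"
proof -
  let ?U = "\<lambda>y. upper_int (frontier D) (Ix D y)"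
  define v where "v y = daniell_int (frontier D) (Ix D y) f" for y
  have "\<forall>n. \<exists>w l. harmonic_on D w \<and> harmonic_on D l \<and> w x + l x < 1 / real (Suc n) \<and>
    (\<forall>y\<in>D. ereal (- l y) \<le> ?U y f \<and> ?U y f \<le> ereal (w y) \<and>
           ereal (- w y) \<le> ?U y (\<lambda>z. - f z) \<and> ?U y (\<lambda>z. - f z) \<le> ereal (l y))"
    using harmonic_sandwich[OF x f] by simp
  then obtain w l where w: "\<And>n. harmonic_on D (w n)" and l: "\<And>n. harmonic_on D (l n)"
    and sx: "\<And>n. w n x + l n x < 1 / real (Suc n)"
    and b: "\<And>n y. y \<in> D \<Longrightarrow> ereal (- l n y) \<le> ?U y f" "\<And>n y. y \<in> D \<Longrightarrow> ?U y f \<le> ereal (w n y)"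
      "\<And>n y. y \<in> D \<Longrightarrow> ereal (- w n y) \<le> ?U y (\<lambda>z. - f z)" "\<And>n y. y \<in> D \<Longrightarrow> ?U y (\<lambda>z. - f z) \<le> ereal (l n y)"
    by metis
  \<comment> \<open>The gap between the bounds \<open>- l n\<close> and \<open>w n\<close>:
    nonnegative, harmonic and small at \<open>x\<close>, so Harnack carries its decay to every
    point.\<close>
  define s where "s n y = w n y + l n y" for n y
  have v: "?U y f = ereal (v y)" if "y \<in> D" for y
    using b(1,2)[OF that, of 0] unfolding v_def daniell_int_def by (cases "?U y f") auto
  have lv: "- l n y \<le> v y" and vw: "v y \<le> w n y" if "y \<in> D" for n y
    using b(1,2)[OF that, of n] v[OF that] by auto
  have s: "harmonic_on D (s n)" "\<forall>y\<in>D. 0 \<le> s n y" for n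
    using w l lv vw unfolding s_def[abs_def] by (auto intro!: harmonic_on_add) (smt (verit))
  have s0: "(\<lambda>n. s n y) \<longlonglongrightarrow> 0" if y: "y \<in> D" for y
  proof -
    obtain C where C: "C \<ge> 0" "\<And>v. harmonic_on D v \<Longrightarrow> (\<forall>z\<in>D. v z \<ge> 0) \<Longrightarrow> v y \<le> C * v x"
      using Harnack_connected[OF op conn x y] by blast
    have bound: "norm (s n y) \<le> C * (1 / real (Suc n))" for n
    proof -
      have "s n y \<le> C * s n x" using C(2) s by blast
      also have "\<dots> \<le> C * (1 / real (Suc n))"
        using C(1) sx[of n] by (intro mult_left_mono) (auto simp: s_def)
      finally show ?thesis using s(2) y by simp
    qed
    have "(\<lambda>n. C * (1 / real (Suc n))) \<longlonglongrightarrow> 0"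
      using tendsto_mult_right_zero[OF LIMSEQ_inverse_real_of_nat] by (simp add: inverse_eq_divide)
    then show ?thesis
      by (rule Lim_null_comparison[OF always_eventually[OF allI[OF bound]]])
  qed
  show "\<forall>y\<in>D. f \<in> daniell_L (frontier D) (Ix D y)"
  proof
    fix y assume y: "y \<in> D"
    obtain t where t: "?U y (\<lambda>z. - f z) = ereal t"
      using b(3,4)[OF y, of 0] by (cases "?U y (\<lambda>z. - f z)") auto
    \<comment> \<open>The number \<open>v y + t\<close> is the upper minus the lower integral;
      \<open>v y\<close> lies between \<open>- l n y\<close> and \<open>w n y\<close>, and
      \<open>t\<close> between \<open>- w n y\<close> and \<open>l n y\<close>.\<close>
    have "\<bar>v y + t\<bar> \<le> s n y" for n
      using b(3,4)[OF y, of n] lv[OF y, of n] vw[OF y, of n] by (simp add: t s_def)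
    then have "\<bar>v y + t\<bar> \<le> 0"
      by (intro LIMSEQ_le_const[OF s0[OF y]]) auto
    then have "t = - v y" by simp
    then show "f \<in> daniell_L (frontier D) (Ix D y)"
      by (simp add: daniell_L_def lower_int_def t v[OF y])
  qed
  have "harmonic_on D v"
  proof (rule harmonic_on_local[OF op])
    fix z assume z: "z \<in> D"
    obtain r where r: "r > 0" "ball z r \<subseteq> D" using openE[OF op z] by blast
    have "harmonic_on (ball z (r / 2 / 2)) v"
    \<comment> \<open>The error of \<open>w n\<close> as an approximation of \<open>v\<close> is at
      most the gap \<open>s n\<close>, which Harnack bounds on the disc by three times its value at
      the centre.\<close>
    proof (rule harmonic_on_uniform_limit[where u = w and e = "\<lambda>n. 3 * s n z"])
      show "harmonic_on (ball z (r / 2)) (w n)" for n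
        using r by (intro harmonic_on_subset[OF w]) auto
      show "(\<lambda>n. 3 * s n z) \<longlonglongrightarrow> 0"
        using tendsto_mult_right_zero[OF s0[OF z]] by simp
      fix n y assume y: "y \<in> ball z (r / 2)"
      have yD: "y \<in> D" using y r by auto
      have "s n y \<le> 3 * s n z"
        using s r y by (intro Harnack_ball[where r = r] harmonic_on_subset[OF s(1)]) auto
      then show "\<bar>w n y - v y\<bar> \<le> 3 * s n z"
        using lv[OF yD, of n] vw[OF yD, of n] by (simp add: s_def)
    qed (use r in simp)
    then show "\<exists>r>0. ball z r \<subseteq> D \<and> harmonic_on (ball z r) v"
      using r by (intro exI[of _ "r / 2 / 2"]) auto
  qed
  then show "harmonic_on D (\<lambda>y. daniell_int (frontier D) (Ix D y) f)"
    by (simp add: v_def[abs_def])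
qed

end

theorem mainTheorem20:
  fixes D :: "(real \<times> real) set" and x :: "real \<times> real" and f :: "real \<times> real \<Rightarrow> ereal"
  assumes "bounded D" and "open D" and "connected D"
    and "\<forall>g. continuous_on (frontier D) g \<longrightarrow>
           (\<exists>u. harmonic_on D u \<and> continuous_on (closure D) u \<and> (\<forall>z\<in>frontier D. u z = g z))"
    and "x \<in> D"
    and "f \<in> daniell_L (frontier D) (Ix D x)"
  shows "(\<forall>y\<in>D. f \<in> daniell_L (frontier D) (Ix D y)) \<and>
         harmonic_on D (\<lambda>y. daniell_int (frontier D) (Ix D y) f)"
proof -
  interpret dirichlet_domain D
    using assms(1-4) by unfold_locales auto
  show ?thesis
    using daniell_L_harmonic[OF assms(5,6)] by blast
qed

end
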